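(* (Double coset formula.) Let $p:H\to G$ be a functor of groupoids and $q:K\to G$ a finite cover of groupoids. Form the strict pullback $H\times_GK$ with projections $\overline p:H\times_GK\to K$ and $\overline q:H\times_GK\to H$. Then $\overline q$ is a finite cover, and there is a natural isomorphism of $(H,K)$-bi-sets $$\alpha:S(\overline p)\otimes_{H\times_GK}T(\overline q)\xrightarrow{\cong}T(q)\otimes_GS(p),$$ given for $\kappa\in K_0$, $\eta\in H_0$ by the map $$K(\overline p,\kappa)\otimes_{H\times_GK}H(\eta,\overline q)\to G(-,q\kappa)\otimes_GG(p\eta,-)$$ sending the class of $(k,h)$ to the class of $(qk,ph)$.
   Context: All groupoids are small; $G_0$ is the object set of $G$. An $(H,G)$-bi-set is a functor $X:H^{\mathrm{op}}\times G\to\mathbf{Set}$, with values $X^\eta_\gamma$. For $X:G^{\mathrm{op}}\to\mathbf{Set}$ and $Y:G\to\mathbf{Set}$, the co-end is $X\otimes_GY=\coprod_{\gamma\in G_0}X^\gamma\times Y_\gamma/\sim$ with $(xg,y)\sim(x,gy)$. For an $(H,G)$-bi-set $X$ and a $(K,H)$-bi-set $Y$, $X\otimes_HY$ is the $(K,G)$-bi-set $(X\otimes_HY)^\kappa_\gamma=X_\gamma\otimes_HY^\kappa$. For a functor $p:H\to G$, $S(p)$ is the $(H,G)$-bi-set $S(p)^\eta_\gamma=G(p\eta,\gamma)$, and, when $p$ is a finite cover, $T(p)$ is the $(G,H)$-bi-set $T(p)^\gamma_\eta=G(\gamma,p\eta)$. $K(\overline p,\kappa)$ denotes the functor $\xi\mapsto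 K(\overline p\xi,\kappa)$ and $H(\eta,\overline q)$ the functor $\xi\mapsto H(\eta,\overline q\xi)$ on $H\times_GK$. A functor of groupoids $q:K\to G$ is a cover if for every $\kappa'\in K_0$ and $g:q\kappa'\to\gamma$ in $G$ there is exactly one pair $(\kappa,\ k:\kappa'\to\kappa)$ with $qk=g$; it is a finite cover if in addition $q^{-1}\gamma$ is finite for all $\gamma\in G_0$. *)

theory Defs
  imports Main
begin

section \<open>Small groupoids, functors and covers\<close>

record ('o, 'a) groupoid =
  Obj :: "'o set"
  Arr :: "'a set"
  Dom :: "'a \<Rightarrow> 'o"
  Cod :: "'a \<Rightarrow> 'o"
  Id :: "'o \<Rightarrow> 'a"
  Comp :: "'a \<Rightarrow> 'a \<Rightarrow> 'a"

text \<open>\<open>Comp G g f\<close> is the composite "g after f"; it is only meaningful if \<open>Dom G g = Cod G f\<close>.\<close>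

definition Hom :: "('o, 'a) groupoid \<Rightarrow> 'o \<Rightarrow> 'o \<Rightarrow> 'a set" where
  "Hom G x y = {f \<in> Arr G. Dom G f = x \<and> Cod G f = y}"

locale groupoid =
  fixes G :: "('o, 'a) groupoid"
  assumes Dom_in: "f \<in> Arr G \<Longrightarrow> Dom G f \<in> Obj G"
    and Cod_in: "f \<in> Arr G \<Longrightarrow> Cod G f \<in> Obj G"
    and Id_in: "x \<in> Obj G \<Longrightarrow> Id G x \<in> Hom G x x"
    and Comp_in: "f \<in> Hom G x y \<Longrightarrow> g \<in> Hom G y z \<Longrightarrow> Comp G g f \<in> Hom G x z"
    and Comp_Id: "f \<in> Hom G x y \<Longrightarrow> Comp G f (Id G x) = f"
    and Id_Comp: "f \<in> Hom G x y \<Longrightarrow> Comp G (Id G y) f = f"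
    and Comp_assoc: "f \<in> Hom G w x \<Longrightarrow> g \<in> Hom G x y \<Longrightarrow> h \<in> Hom G y z \<Longrightarrow>
      Comp G h (Comp G g f) = Comp G (Comp G h g) f"
    and inverse_ex: "f \<in> Hom G x y \<Longrightarrow>
      \<exists>g \<in> Hom G y x. Comp G g f = Id G x \<and> Comp G f g = Id G y"

record ('o1, 'a1, 'o2, 'a2) gfunctor =
  on_obj :: "'o1 \<Rightarrow> 'o2"
  on_arr :: "'a1 \<Rightarrow> 'a2"

locale groupoid_functor = source: groupoid H + target: groupoid G
  for H :: "('ho, 'ha) groupoid" and G :: "('go, 'ga) groupoid" +
  fixes p :: "('ho, 'ha, 'go, 'ga) gfunctor"
  assumes on_obj_in: "x \<in> Obj H \<Longrightarrow> on_obj p x \<in> Obj G"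
    and on_arr_in: "f \<in> Hom H x y \<Longrightarrow> on_arr p f \<in> Hom G (on_obj p x) (on_obj p y)"
    and on_arr_Id: "x \<in> Obj H \<Longrightarrow> on_arr p (Id H x) = Id G (on_obj p x)"
    and on_arr_Comp: "f \<in> Hom H x y \<Longrightarrow> g \<in> Hom H y z \<Longrightarrow>
      on_arr p (Comp H g f) = Comp G (on_arr p g) (on_arr p f)"

locale cover = groupoid_functor K G q
  for K :: "('ko, 'ka) groupoid" and G :: "('go, 'ga) groupoid"
    and q :: "('ko, 'ka, 'go, 'ga) gfunctor" +
  assumes unique_lift: "\<kappa>' \<in> Obj K \<Longrightarrow> \<gamma> \<in> Obj G \<Longrightarrow> g \<in> Hom G (on_obj q \<kappa>') \<gamma> \<Longrightarrow>
    \<exists>!z. fst z \<in> Obj K \<and> snd z \<in> Hom K \<kappa>' (fst z) \<and> on_arr q (snd z) = g"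

locale finite_cover = cover K G q
  for K :: "('ko, 'ka) groupoid" and G :: "('go, 'ga) groupoid"
    and q :: "('ko, 'ka, 'go, 'ga) gfunctor" +
  assumes finite_fibre: "\<gamma> \<in> Obj G \<Longrightarrow> finite {\<kappa> \<in> Obj K. on_obj q \<kappa> = \<gamma>}"


section \<open>The strict pullback\<close>

definition pullback ::
  "('ho, 'ha) groupoid \<Rightarrow> ('ko, 'ka) groupoid \<Rightarrow> ('ho, 'ha, 'go, 'ga) gfunctor \<Rightarrow>
   ('ko, 'ka, 'go, 'ga) gfunctor \<Rightarrow> ('ho \<times> 'ko, 'ha \<times> 'ka) groupoid" where
  "pullback H K p q = \<lparr>
     Obj = {(\<eta>, \<kappa>). \<eta> \<in> Obj H \<and> \<kappa> \<in> Obj K \<and> on_obj p \<eta> = on_obj q \<kappa>},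
     Arr = {(h, k). h \<in> Arr H \<and> k \<in> Arr K \<and> on_arr p h = on_arr q k},
     Dom = (\<lambda>(h, k). (Dom H h, Dom K k)),
     Cod = (\<lambda>(h, k). (Cod H h, Cod K k)),
     Id = (\<lambda>(\<eta>, \<kappa>). (Id H \<eta>, Id K \<kappa>)),
     Comp = (\<lambda>(h', k') (h, k). (Comp H h' h, Comp K k' k))\<rparr>"

definition proj_fst :: "('ho \<times> 'ko, 'ha \<times> 'ka, 'ho, 'ha) gfunctor" where
  "proj_fst = \<lparr>on_obj = fst, on_arr = fst\<rparr>"

definition proj_snd :: "('ho \<times> 'ko, 'ha \<times> 'ka, 'ko, 'ka) gfunctor" where
  "proj_snd = \<lparr>on_obj = snd, on_arr = snd\<rparr>"


lemma groupoid_pullback: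
  assumes "groupoid_functor H G p" "groupoid_functor K G q"
  shows "groupoid (pullback H K p q)"
proof -
  interpret p: groupoid_functor H G p by fact
  interpret q: groupoid_functor K G q by fact
  let ?P = "pullback H K p q"
  have Hom_P: "f \<in> Hom ?P x y \<longleftrightarrow> fst f \<in> Hom H (fst x) (fst y) \<and>
      snd f \<in> Hom K (snd x) (snd y) \<and> on_arr p (fst f) = on_arr q (snd f)" for f x y
    by (cases f; cases x; cases y) (auto simp: Hom_def pullback_def)
  have Comp_P: "Comp ?P g f = (Comp H (fst g) (fst f), Comp K (snd g) (snd f))" for f g
    by (simp add: pullback_def case_prod_beta)
  have Id_P: "Id ?P x = (Id H (fst x), Id K (snd x))" for x
    by (simp add: pullback_def case_prod_beta)
  have p_ends: "on_obj p (Dom H h) = Dom G (on_arr p h)" "on_obj p (Cod H h) = Cod G (on_arr p h)"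
    if "h \<in> Arr H" for h
    using p.on_arr_in[of h "Dom H h" "Cod H h"] that by (auto simp: Hom_def)
  have q_ends: "on_obj q (Dom K k) = Dom G (on_arr q k)" "on_obj q (Cod K k) = Cod G (on_arr q k)"
    if "k \<in> Arr K" for k
    using q.on_arr_in[of k "Dom K k" "Cod K k"] that by (auto simp: Hom_def)
  have inv_eq: "u = v" if "f \<in> Hom G x y" "u \<in> Hom G y x" "v \<in> Hom G y x"
      "Comp G u f = Id G x" "Comp G f v = Id G y" for f u v x y
    using that p.target.Comp_assoc[of v y x f y u x] p.target.Comp_Id p.target.Id_Comp by metis
  show ?thesis
  proof
    fix f assume "f \<in> Arr ?P"
    then show "Dom ?P f \<in> Obj ?P" "Cod ?P f \<in> Obj ?P"
      by (auto simp: pullback_def p_ends q_ends p.source.Dom_in p.source.Cod_in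
          q.source.Dom_in q.source.Cod_in)
  next
    fix x assume "x \<in> Obj ?P"
    then show "Id ?P x \<in> Hom ?P x x"
      by (auto simp: Hom_P Id_P p.source.Id_in q.source.Id_in p.on_arr_Id q.on_arr_Id)
         (auto simp: pullback_def p.source.Id_in q.source.Id_in p.on_arr_Id q.on_arr_Id)
  next
    fix f g x y z assume "f \<in> Hom ?P x y" "g \<in> Hom ?P y z"
    then show "Comp ?P g f \<in> Hom ?P x z"
      by (auto simp: Hom_P Comp_P p.source.Comp_in q.source.Comp_in p.on_arr_Comp q.on_arr_Comp)
  next
    fix f x y assume "f \<in> Hom ?P x y"
    then show "Comp ?P f (Id ?P x) = f" "Comp ?P (Id ?P y) f = f"
      by (auto simp: Hom_P Comp_P Id_P p.source.Comp_Id q.source.Comp_Id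
          p.source.Id_Comp q.source.Id_Comp intro!: prod_eqI)
  next
    fix f g h w x y z assume "f \<in> Hom ?P w x" "g \<in> Hom ?P x y" "h \<in> Hom ?P y z"
    then show "Comp ?P h (Comp ?P g f) = Comp ?P (Comp ?P h g) f"
      by (auto simp: Hom_P Comp_P p.source.Comp_assoc q.source.Comp_assoc)
  next
    fix f x y assume f: "f \<in> Hom ?P x y"
    then have fH: "fst f \<in> Hom H (fst x) (fst y)" and fK: "snd f \<in> Hom K (snd x) (snd y)"
      and eq: "on_arr p (fst f) = on_arr q (snd f)" by (auto simp: Hom_P)
    obtain h where h: "h \<in> Hom H (fst y) (fst x)" "Comp H h (fst f) = Id H (fst x)"
      "Comp H (fst f) h = Id H (fst y)" using p.source.inverse_ex[OF fH] by auto
    obtain k where k: "k \<in> Hom K (snd y) (snd x)" "Comp K k (snd f) = Id K (snd x)"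
      "Comp K (snd f) k = Id K (snd y)" using q.source.inverse_ex[OF fK] by auto
    have obj: "fst x \<in> Obj H" "fst y \<in> Obj H" "snd x \<in> Obj K" "snd y \<in> Obj K"
      using fH fK p.source.Dom_in[of "fst f"] p.source.Cod_in[of "fst f"]
        q.source.Dom_in[of "snd f"] q.source.Cod_in[of "snd f"] by (auto simp: Hom_def)
    have xy: "on_obj p (fst x) = on_obj q (snd x)" "on_obj p (fst y) = on_obj q (snd y)"
      using p.on_arr_in[OF fH] q.on_arr_in[OF fK] eq by (auto simp: Hom_def)
    have "on_arr p h = on_arr q k"
    proof (rule inv_eq)
      show "on_arr p (fst f) \<in> Hom G (on_obj p (fst x)) (on_obj p (fst y))"
        using p.on_arr_in fH by blast
      show "on_arr p h \<in> Hom G (on_obj p (fst y)) (on_obj p (fst x))"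
        using p.on_arr_in h by blast
      show "on_arr q k \<in> Hom G (on_obj p (fst y)) (on_obj p (fst x))"
        using q.on_arr_in k xy by metis
      show "Comp G (on_arr p h) (on_arr p (fst f)) = Id G (on_obj p (fst x))"
        using p.on_arr_Comp[OF fH h(1)] h(2) p.on_arr_Id obj by metis
      show "Comp G (on_arr p (fst f)) (on_arr q k) = Id G (on_obj p (fst y))"
        using q.on_arr_Comp[OF k(1) fK] k(3) q.on_arr_Id obj eq xy by metis
    qed
    then show "\<exists>g \<in> Hom ?P y x. Comp ?P g f = Id ?P x \<and> Comp ?P f g = Id ?P y"
      using h k by (intro bexI[of _ "(h, k)"]) (auto simp: Hom_P Comp_P Id_P)
  qed
qed

lemma groupoid_functor_proj:
  assumes "groupoid_functor H G p" "groupoid_functor K G q"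
  shows "groupoid_functor (pullback H K p q) H proj_fst"
    and "groupoid_functor (pullback H K p q) K proj_snd"
proof -
  interpret p: groupoid_functor H G p by fact
  interpret q: groupoid_functor K G q by fact
  interpret P: groupoid "pullback H K p q" using assms by (rule groupoid_pullback)
  show "groupoid_functor (pullback H K p q) H proj_fst"
    by unfold_locales (auto simp: pullback_def proj_fst_def Hom_def)
  show "groupoid_functor (pullback H K p q) K proj_snd"
    by unfold_locales (auto simp: pullback_def proj_snd_def Hom_def)
qed


section \<open>Set-valued functors and co-ends\<close>

text \<open>
  Raw data of a set-valued functor on a groupoid. For a covariant functor, \<open>act Y g\<close> maps
  \<open>elts Y (Dom G g)\<close> to \<open>elts Y (Cod G g)\<close>; for a contravariant one, \<open>act X g\<close> maps
  \<open>elts X (Cod G g)\<close> to \<open>elts X (Dom G g)\<close>.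
\<close>

record ('o, 'a, 'x) gset =
  elts :: "'o \<Rightarrow> 'x set"
  act :: "'a \<Rightarrow> 'x \<Rightarrow> 'x"

definition coprod ::
  "('o, 'a) groupoid \<Rightarrow> ('o, 'a, 'x) gset \<Rightarrow> ('o, 'a, 'y) gset \<Rightarrow> ('o \<times> 'x \<times> 'y) set" where
  "coprod G X Y = (SIGMA \<gamma> : Obj G. elts X \<gamma> \<times> elts Y \<gamma>)"

inductive coend_step ::
  "('o, 'a) groupoid \<Rightarrow> ('o, 'a, 'x) gset \<Rightarrow> ('o, 'a, 'y) gset \<Rightarrow>
   'o \<times> 'x \<times> 'y \<Rightarrow> 'o \<times> 'x \<times> 'y \<Rightarrow> bool" for G X Y where
  "g \<in> Hom G \<gamma> \<gamma>' \<Longrightarrow> x \<in> elts X \<gamma>' \<Longrightarrow> y \<in> elts Y \<gamma> \<Longrightarrow>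
   coend_step G X Y (\<gamma>, act X g x, y) (\<gamma>', x, act Y g y)"

definition coend_rel ::
  "('o, 'a) groupoid \<Rightarrow> ('o, 'a, 'x) gset \<Rightarrow> ('o, 'a, 'y) gset \<Rightarrow> ('o \<times> 'x \<times> 'y) rel" where
  "coend_rel G X Y =
    {(s, t). s \<in> coprod G X Y \<and> t \<in> coprod G X Y \<and> equivclp (coend_step G X Y) s t}"

definition coend ::
  "('o, 'a) groupoid \<Rightarrow> ('o, 'a, 'x) gset \<Rightarrow> ('o, 'a, 'y) gset \<Rightarrow> ('o \<times> 'x \<times> 'y) set set" where
  "coend G X Y = coprod G X Y // coend_rel G X Y"


section \<open>Bi-sets\<close>

record ('ho, 'ha, 'go, 'ga, 'x) biset =
  bi_elts :: "'ho \<Rightarrow> 'go \<Rightarrow> 'x set"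
  bi_act :: "'ha \<Rightarrow> 'ga \<Rightarrow> 'x \<Rightarrow> 'x"

locale biset = left: groupoid H + right: groupoid G
  for H :: "('ho, 'ha) groupoid" and G :: "('go, 'ga) groupoid" +
  fixes X :: "('ho, 'ha, 'go, 'ga, 'x) biset"
  assumes bi_act_in: "h \<in> Hom H \<eta> \<eta>' \<Longrightarrow> g \<in> Hom G \<gamma> \<gamma>' \<Longrightarrow> x \<in> bi_elts X \<eta>' \<gamma> \<Longrightarrow>
      bi_act X h g x \<in> bi_elts X \<eta> \<gamma>'"
    and bi_act_Id: "\<eta> \<in> Obj H \<Longrightarrow> \<gamma> \<in> Obj G \<Longrightarrow> x \<in> bi_elts X \<eta> \<gamma> \<Longrightarrow>
      bi_act X (Id H \<eta>) (Id G \<gamma>) x = x"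
    and bi_act_Comp: "h \<in> Hom H \<eta> \<eta>' \<Longrightarrow> h' \<in> Hom H \<eta>' \<eta>'' \<Longrightarrow>
      g \<in> Hom G \<gamma> \<gamma>' \<Longrightarrow> g' \<in> Hom G \<gamma>' \<gamma>'' \<Longrightarrow> x \<in> bi_elts X \<eta>'' \<gamma> \<Longrightarrow>
      bi_act X (Comp H h' h) (Comp G g' g) x = bi_act X h g' (bi_act X h' g x)"

locale biset_natural_iso = source: biset H G X + target: biset H G Y
  for H :: "('ho, 'ha) groupoid" and G :: "('go, 'ga) groupoid"
    and X :: "('ho, 'ha, 'go, 'ga, 'x) biset" and Y :: "('ho, 'ha, 'go, 'ga, 'y) biset" +
  fixes \<alpha> :: "'ho \<Rightarrow> 'go \<Rightarrow> 'x \<Rightarrow> 'y"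
  assumes component_bij: "\<eta> \<in> Obj H \<Longrightarrow> \<gamma> \<in> Obj G \<Longrightarrow>
      bij_betw (\<alpha> \<eta> \<gamma>) (bi_elts X \<eta> \<gamma>) (bi_elts Y \<eta> \<gamma>)"
    and naturality: "h \<in> Hom H \<eta> \<eta>' \<Longrightarrow> g \<in> Hom G \<gamma> \<gamma>' \<Longrightarrow> x \<in> bi_elts X \<eta>' \<gamma> \<Longrightarrow>
      \<alpha> \<eta> \<gamma>' (bi_act X h g x) = bi_act Y h g (\<alpha> \<eta>' \<gamma> x)"

text \<open>For an (H,G)-bi-set X, the contravariant functor \<open>X\<^sub>\<gamma>\<close> on H.\<close>

definition lower_slice ::
  "('go, 'ga) groupoid \<Rightarrow> ('ho, 'ha, 'go, 'ga, 'x) biset \<Rightarrow> 'go \<Rightarrow> ('ho, 'ha, 'x) gset" where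
  "lower_slice G X \<gamma> =
    \<lparr>elts = (\<lambda>\<eta>. bi_elts X \<eta> \<gamma>), act = (\<lambda>h. bi_act X h (Id G \<gamma>))\<rparr>"

text \<open>For a (K,H)-bi-set Y, the covariant functor \<open>Y\<^sup>\<kappa>\<close> on H.\<close>

definition upper_slice ::
  "('ko, 'ka) groupoid \<Rightarrow> ('ko, 'ka, 'ho, 'ha, 'y) biset \<Rightarrow> 'ko \<Rightarrow> ('ho, 'ha, 'y) gset" where
  "upper_slice K Y \<kappa> =
    \<lparr>elts = (\<lambda>\<eta>. bi_elts Y \<kappa> \<eta>), act = (\<lambda>h. bi_act Y (Id K \<kappa>) h)\<rparr>"

definition tensor_rel ::
  "('ko, 'ka) groupoid \<Rightarrow> ('ho, 'ha) groupoid \<Rightarrow> ('go, 'ga) groupoid \<Rightarrow>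
   ('ho, 'ha, 'go, 'ga, 'x) biset \<Rightarrow> ('ko, 'ka, 'ho, 'ha, 'y) biset \<Rightarrow>
   'ko \<Rightarrow> 'go \<Rightarrow> ('ho \<times> 'x \<times> 'y) rel" where
  "tensor_rel K H G X Y \<kappa> \<gamma> = coend_rel H (lower_slice G X \<gamma>) (upper_slice K Y \<kappa>)"

definition tensor_class ::
  "('ko, 'ka) groupoid \<Rightarrow> ('ho, 'ha) groupoid \<Rightarrow> ('go, 'ga) groupoid \<Rightarrow>
   ('ho, 'ha, 'go, 'ga, 'x) biset \<Rightarrow> ('ko, 'ka, 'ho, 'ha, 'y) biset \<Rightarrow>
   'ko \<Rightarrow> 'go \<Rightarrow> 'ho \<times> 'x \<times> 'y \<Rightarrow> ('ho \<times> 'x \<times> 'y) set" where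
  "tensor_class K H G X Y \<kappa> \<gamma> t = tensor_rel K H G X Y \<kappa> \<gamma> `` {t}"

text \<open>
  The action on classes is induced by \<open>(\<eta>, x, y) \<mapsto> (\<eta>, xg, ky)\<close> on representatives: a class C
  is sent to the saturation of the image of C, which is a single class.
\<close>

definition tensor ::
  "('ko, 'ka) groupoid \<Rightarrow> ('ho, 'ha) groupoid \<Rightarrow> ('go, 'ga) groupoid \<Rightarrow>
   ('ho, 'ha, 'go, 'ga, 'x) biset \<Rightarrow> ('ko, 'ka, 'ho, 'ha, 'y) biset \<Rightarrow>
   ('ko, 'ka, 'go, 'ga, ('ho \<times> 'x \<times> 'y) set) biset" where
  "tensor K H G X Y = \<lparr>
     bi_elts = (\<lambda>\<kappa> \<gamma>. coend H (lower_slice G X \<gamma>) (upper_slice K Y \<kappa>)),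
     bi_act = (\<lambda>k g C. tensor_rel K H G X Y (Dom K k) (Cod G g) ``
       ((\<lambda>(\<eta>, x, y). (\<eta>, bi_act X (Id H \<eta>) g x, bi_act Y k (Id H \<eta>) y)) ` C))\<rparr>"

definition S_biset ::
  "('go, 'ga) groupoid \<Rightarrow> ('ho, 'ha, 'go, 'ga) gfunctor \<Rightarrow> ('ho, 'ha, 'go, 'ga, 'ga) biset" where
  "S_biset G p = \<lparr>
     bi_elts = (\<lambda>\<eta> \<gamma>. Hom G (on_obj p \<eta>) \<gamma>),
     bi_act = (\<lambda>h g x. Comp G g (Comp G x (on_arr p h)))\<rparr>"

definition T_biset ::
  "('go, 'ga) groupoid \<Rightarrow> ('ho, 'ha, 'go, 'ga) gfunctor \<Rightarrow> ('go, 'ga, 'ho, 'ha, 'ga) biset" where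
  "T_biset G p = \<lparr>
     bi_elts = (\<lambda>\<gamma> \<eta>. Hom G \<gamma> (on_obj p \<eta>)),
     bi_act = (\<lambda>g h x. Comp G (on_arr p h) (Comp G x g))\<rparr>"

lemma biset_S:
  assumes "groupoid_functor H G p"
  shows "biset H G (S_biset G p)"
proof -
  interpret groupoid_functor H G p by fact
  show ?thesis
  proof unfold_locales
    fix h \<eta> \<eta>' g \<gamma> \<gamma>' x
    assume "h \<in> Hom H \<eta> \<eta>'" "g \<in> Hom G \<gamma> \<gamma>'" "x \<in> bi_elts (S_biset G p) \<eta>' \<gamma>"
    then show "bi_act (S_biset G p) h g x \<in> bi_elts (S_biset G p) \<eta> \<gamma>'"
      unfolding S_biset_def using on_arr_in target.Comp_in by (auto; blast)
  next
    fix \<eta> \<gamma> x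
    assume "\<eta> \<in> Obj H" "\<gamma> \<in> Obj G" "x \<in> bi_elts (S_biset G p) \<eta> \<gamma>"
    then show "bi_act (S_biset G p) (Id H \<eta>) (Id G \<gamma>) x = x"
      by (simp add: S_biset_def on_arr_Id target.Comp_Id target.Id_Comp)
  next
    fix h \<eta> \<eta>' h' \<eta>'' g \<gamma> \<gamma>' g' \<gamma>'' x
    assume h: "h \<in> Hom H \<eta> \<eta>'" "h' \<in> Hom H \<eta>' \<eta>''" and g: "g \<in> Hom G \<gamma> \<gamma>'" "g' \<in> Hom G \<gamma>' \<gamma>''"
      and "x \<in> bi_elts (S_biset G p) \<eta>'' \<gamma>"
    then have x: "x \<in> Hom G (on_obj p \<eta>'') \<gamma>" by (simp add: S_biset_def)
    note ph = h[THEN on_arr_in]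
    note xh' = target.Comp_in[OF ph(2) x]
    show "bi_act (S_biset G p) (Comp H h' h) (Comp G g' g) x =
        bi_act (S_biset G p) h g' (bi_act (S_biset G p) h' g x)"
      by (simp add: S_biset_def on_arr_Comp[OF h] target.Comp_assoc[OF ph x]
          target.Comp_assoc[OF ph(1) xh' g(1)]
          target.Comp_assoc[OF target.Comp_in[OF ph(1) xh'] g, symmetric])
  qed
qed

lemma biset_T:
  assumes "groupoid_functor H G p"
  shows "biset G H (T_biset G p)"
proof -
  interpret groupoid_functor H G p by fact
  show ?thesis
  proof unfold_locales
    fix g \<gamma> \<gamma>' h \<eta> \<eta>' x
    assume "g \<in> Hom G \<gamma> \<gamma>'" "h \<in> Hom H \<eta> \<eta>'" "x \<in> bi_elts (T_biset G p) \<gamma>' \<eta>"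
    then show "bi_act (T_biset G p) g h x \<in> bi_elts (T_biset G p) \<gamma> \<eta>'"
      unfolding T_biset_def using on_arr_in target.Comp_in by (auto; blast)
  next
    fix \<gamma> \<eta> x
    assume "\<gamma> \<in> Obj G" "\<eta> \<in> Obj H" "x \<in> bi_elts (T_biset G p) \<gamma> \<eta>"
    then show "bi_act (T_biset G p) (Id G \<gamma>) (Id H \<eta>) x = x"
      by (simp add: T_biset_def on_arr_Id target.Comp_Id target.Id_Comp)
  next
    fix g \<gamma> \<gamma>' g' \<gamma>'' h \<eta> \<eta>' h' \<eta>'' x
    assume g: "g \<in> Hom G \<gamma> \<gamma>'" "g' \<in> Hom G \<gamma>' \<gamma>''" and h: "h \<in> Hom H \<eta> \<eta>'" "h' \<in> Hom H \<eta>' \<eta>''"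
      and "x \<in> bi_elts (T_biset G p) \<gamma>'' \<eta>"
    then have x: "x \<in> Hom G \<gamma>'' (on_obj p \<eta>)" by (simp add: T_biset_def)
    note ph = h[THEN on_arr_in]
    note xg' = target.Comp_in[OF g(2) x]
    show "bi_act (T_biset G p) (Comp G g' g) (Comp H h' h) x =
        bi_act (T_biset G p) g h' (bi_act (T_biset G p) g' h x)"
      by (simp add: T_biset_def on_arr_Comp[OF h] target.Comp_assoc[OF g x]
          target.Comp_assoc[OF g(1) xg' ph(1)]
          target.Comp_assoc[OF target.Comp_in[OF g(1) xg'] ph, symmetric])
  qed
qed

end

(*
  Composition identifies the class of (a, b) in T(q) tensor S(p) with the arrow a b in
  G(p eta, q kappa). On the other side, the class of (k, h) is determined by g = (q k) (p h):
  lifting p h along the cover q to an arrow m ending at the source of k gives an arrow (h, m) of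
  the pullback, so that (k, h) ~ (k m, id), and k m is the unique lift of g ending at kappa. Hence
  both sides are in bijection with G(p eta, q kappa), compatibly with the map (k, h) |-> (q k, p h).
*)
theory Submission
  imports Defs
begin

section \<open>Zigzags of generating steps, and the maps they induce on co-end classes\<close>

section \<open>Co-ends\<close>

text \<open>A zigzag is transported one step at a time, each step being read in either direction. A
  generating step only has to land in the closure of \<open>r'\<close>, not in a single step of
  it.\<close>

lemma equivclp_map:
  assumes "equivclp r s t" and "\<And>u v. r u v \<Longrightarrow> equivclp r' (f u) (f v)"
  shows "equivclp r' (f s) (f t)"
  using assms(1)
proof (induction rule: equivclp_induct)
  case base
  show ?case by simp
next
  case (step u v)
  then have "equivclp r' (f u) (f v)"
    using assms(2) equivclp_sym by metis
  with step.IH show ?case by (rule equivclp_trans)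
qed

text \<open>This is the tool for telling classes apart: below, \<open>w\<close> will be a composite
  arrow of G that does not change along a generating step.\<close>

lemma equivclp_invariant:
  assumes "equivclp r s t" and "\<And>u v. r u v \<Longrightarrow> w u = w v"
  shows "w s = w t"
  using assms(1)
proof (induction rule: equivclp_induct)
  case (step u v)
  then show ?case using assms(2) by metis
qed simp

lemma equiv_coend_rel: "equiv (coprod G X Y) (coend_rel G X Y)"
  by (rule equivI)
     (auto simp: refl_on_def sym_def trans_def coend_rel_def
       intro: equivclp_sym equivclp_trans)

lemma coend_class_in: "t \<in> coprod G X Y \<Longrightarrow> coend_rel G X Y `` {t} \<in> coend G X Y"
  by (simp add: coend_def quotientI)

lemma coendE:
  assumes "C \<in> coend G X Y"
  obtains \<gamma> x y where "(\<gamma>, x, y) \<in> coprod G X Y" "C = coend_rel G X Y `` {(\<gamma>, x, y)}"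
proof -
  obtain t where "t \<in> coprod G X Y" "C = coend_rel G X Y `` {t}"
    using assms unfolding coend_def by (auto elim: quotientE)
  then show thesis using that by (cases t) auto
qed

lemma coend_class_eq_iff:
  assumes "s \<in> coprod G X Y" "t \<in> coprod G X Y"
  shows "coend_rel G X Y `` {s} = coend_rel G X Y `` {t} \<longleftrightarrow> equivclp (coend_step G X Y) s t"
  using eq_equiv_class_iff[OF equiv_coend_rel assms] assms by (simp add: coend_rel_def)

text \<open>An induced map on co-ends is written without choosing representatives, as the saturation
  of the image of a class. Since f carries zigzags to zigzags, all points of the class of t have
  images in one class, and t itself is among them, so the union of their classes collapses to the
  class of \<open>f t\<close>.\<close>

lemma coend_rel_image_class:
  assumes t: "t \<in> coprod G X Y"
    and closed: "\<And>u. u \<in> coprod G X Y \<Longrightarrow> f u \<in> coprod G' X' Y'"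
    and step: "\<And>u v. coend_step G X Y u v \<Longrightarrow> equivclp (coend_step G' X' Y') (f u) (f v)"
  shows "coend_rel G' X' Y' `` (f ` (coend_rel G X Y `` {t})) = coend_rel G' X' Y' `` {f t}"
proof -
  have cls: "coend_rel G' X' Y' `` {f u} = coend_rel G' X' Y' `` {f t}"
    if "u \<in> coend_rel G X Y `` {t}" for u
  proof (rule equiv_class_eq[OF equiv_coend_rel, symmetric])
    from that have u: "u \<in> coprod G X Y" and "equivclp (coend_step G X Y) t u"
      by (auto simp: coend_rel_def)
    then have "equivclp (coend_step G' X' Y') (f t) (f u)"
      using step by (blast intro: equivclp_map)
    with t u show "(f t, f u) \<in> coend_rel G' X' Y'"
      by (simp add: coend_rel_def closed)
  qed
  have "t \<in> coend_rel G X Y `` {t}"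
    using equiv_class_self[OF equiv_coend_rel t] .
  moreover have "coend_rel G' X' Y' `` (f ` (coend_rel G X Y `` {t})) =
      (\<Union>u \<in> coend_rel G X Y `` {t}. coend_rel G' X' Y' `` {f u})"
    by blast
  ultimately show ?thesis using cls by blast
qed


section \<open>Functor laws for the outer actions on a tensor product, checked on
  representatives\<close>

section \<open>The tensor product of bi-sets is a bi-set\<close>

context groupoid
begin

lemma Hom_objs: "f \<in> Hom G x y \<Longrightarrow> x \<in> Obj G \<and> y \<in> Obj G"
  using Dom_in Cod_in by (auto simp: Hom_def)

lemma Id_Comp_Id: "x \<in> Obj G \<Longrightarrow> Comp G (Id G x) (Id G x) = Id G x"
  using Comp_Id Id_in by blast

end

context biset
begin

text \<open>Both sides equal \<open>bi_act X h g x\<close>: functoriality is applied to the two ways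
  of padding h and g with identities, at their sources and at their targets.\<close>

lemma bi_act_interchange:
  assumes h: "h \<in> Hom H \<eta> \<eta>'" and g: "g \<in> Hom G \<gamma> \<gamma>'" and x: "x \<in> bi_elts X \<eta>' \<gamma>"
  shows "bi_act X (Id H \<eta>) g (bi_act X h (Id G \<gamma>) x) =
    bi_act X h (Id G \<gamma>') (bi_act X (Id H \<eta>') g x)"
proof -
  have o: "\<eta> \<in> Obj H" "\<eta>' \<in> Obj H" "\<gamma> \<in> Obj G" "\<gamma>' \<in> Obj G"
    using left.Hom_objs[OF h] right.Hom_objs[OF g] by auto
  show ?thesis
    using bi_act_Comp[OF left.Id_in[OF o(1)] h right.Id_in[OF o(3)] g x]
      bi_act_Comp[OF h left.Id_in[OF o(2)] g right.Id_in[OF o(4)] x]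
    by (simp add: left.Comp_Id[OF h] left.Id_Comp[OF h] right.Comp_Id[OF g] right.Id_Comp[OF g])
qed

lemma bi_act_Comp_right:
  assumes "\<eta> \<in> Obj H" "g \<in> Hom G \<gamma> \<gamma>'" "g' \<in> Hom G \<gamma>' \<gamma>''" "x \<in> bi_elts X \<eta> \<gamma>"
  shows "bi_act X (Id H \<eta>) (Comp G g' g) x = bi_act X (Id H \<eta>) g' (bi_act X (Id H \<eta>) g x)"
  using bi_act_Comp[OF left.Id_in[OF assms(1)] left.Id_in[OF assms(1)] assms(2-4)]
  by (simp add: left.Id_Comp_Id assms(1))

lemma bi_act_Comp_left:
  assumes "\<gamma> \<in> Obj G" "h \<in> Hom H \<eta> \<eta>'" "h' \<in> Hom H \<eta>' \<eta>''" "x \<in> bi_elts X \<eta>'' \<gamma>"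
  shows "bi_act X (Comp H h' h) (Id G \<gamma>) x = bi_act X h (Id G \<gamma>) (bi_act X h' (Id G \<gamma>) x)"
  using bi_act_Comp[OF assms(2,3) right.Id_in[OF assms(1)] right.Id_in[OF assms(1)] assms(4)]
  by (simp add: right.Id_Comp_Id assms(1))

end

lemma elts_lower_slice [simp]: "elts (lower_slice G X \<gamma>) \<eta> = bi_elts X \<eta> \<gamma>"
  and act_lower_slice [simp]: "act (lower_slice G X \<gamma>) h = bi_act X h (Id G \<gamma>)"
  and elts_upper_slice [simp]: "elts (upper_slice K Y \<kappa>) \<eta> = bi_elts Y \<kappa> \<eta>"
  and act_upper_slice [simp]: "act (upper_slice K Y \<kappa>) h = bi_act Y (Id K \<kappa>) h"
  by (simp_all add: lower_slice_def upper_slice_def)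

lemma coprod_slices [simp]:
  "(\<eta>, x, y) \<in> coprod H (lower_slice G X \<gamma>) (upper_slice K Y \<kappa>) \<longleftrightarrow>
    \<eta> \<in> Obj H \<and> x \<in> bi_elts X \<eta> \<gamma> \<and> y \<in> bi_elts Y \<kappa> \<eta>"
  by (simp add: coprod_def)

lemma tensor_class_in:
  assumes "(\<eta>, x, y) \<in> coprod H (lower_slice G X \<gamma>) (upper_slice K Y \<kappa>)"
  shows "tensor_class K H G X Y \<kappa> \<gamma> (\<eta>, x, y) \<in> bi_elts (tensor K H G X Y) \<kappa> \<gamma>"
  using coend_class_in[OF assms] by (simp add: tensor_def tensor_class_def tensor_rel_def)

lemma tensor_eltE:
  assumes "C \<in> bi_elts (tensor K H G X Y) \<kappa> \<gamma>"
  obtains \<eta> x y where "\<eta> \<in> Obj H" "x \<in> bi_elts X \<eta> \<gamma>" "y \<in> bi_elts Y \<kappa> \<eta>"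
    "C = tensor_class K H G X Y \<kappa> \<gamma> (\<eta>, x, y)"
  using assms by (auto simp: tensor_def tensor_class_def tensor_rel_def elim!: coendE)

text \<open>Here the action on classes is shown to be well defined. The outer arrows g and k commute
  with the inner action of H by interchange, so the images of the two ends of a generating step
  again form a generating step, along the same arrow of H.\<close>

lemma tensor_act_class:
  assumes "biset H G X" "biset K H Y"
    and k: "k \<in> Hom K \<kappa> \<kappa>'" and g: "g \<in> Hom G \<gamma> \<gamma>'"
    and t: "\<eta> \<in> Obj H" "x \<in> bi_elts X \<eta> \<gamma>" "y \<in> bi_elts Y \<kappa>' \<eta>"
  shows "bi_act (tensor K H G X Y) k g (tensor_class K H G X Y \<kappa>' \<gamma> (\<eta>, x, y)) =
    tensor_class K H G X Y \<kappa> \<gamma>' (\<eta>, bi_act X (Id H \<eta>) g x, bi_act Y k (Id H \<eta>) y)"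
proof -
  interpret X: biset H G X by fact
  interpret Y: biset K H Y by fact
  let ?f = "\<lambda>(\<eta>, x, y). (\<eta>, bi_act X (Id H \<eta>) g x, bi_act Y k (Id H \<eta>) y)"
  let ?X = "lower_slice G X \<gamma>" and ?Y = "upper_slice K Y \<kappa>'"
  let ?X' = "lower_slice G X \<gamma>'" and ?Y' = "upper_slice K Y \<kappa>"
  have "coend_rel H ?X' ?Y' `` (?f ` (coend_rel H ?X ?Y `` {(\<eta>, x, y)})) =
      coend_rel H ?X' ?Y' `` {?f (\<eta>, x, y)}"
  proof (rule coend_rel_image_class)
    show "(\<eta>, x, y) \<in> coprod H ?X ?Y" using t by simp
  next
    fix u assume "u \<in> coprod H ?X ?Y"
    then show "?f u \<in> coprod H ?X' ?Y'"
      using X.bi_act_in[OF X.left.Id_in g] Y.bi_act_in[OF k X.left.Id_in]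
      by (cases u) simp
  next
    fix u v assume "coend_step H ?X ?Y u v"
    then show "equivclp (coend_step H ?X' ?Y') (?f u) (?f v)"
    proof cases
      case (1 h \<zeta> \<zeta>' a b)
      then have h: "h \<in> Hom H \<zeta> \<zeta>'" and a: "a \<in> bi_elts X \<zeta>' \<gamma>" and b: "b \<in> bi_elts Y \<kappa>' \<zeta>"
        by auto
      have o: "\<zeta> \<in> Obj H" "\<zeta>' \<in> Obj H" using X.left.Hom_objs[OF h] by auto
      have "coend_step H ?X' ?Y'
          (\<zeta>, act ?X' h (bi_act X (Id H \<zeta>') g a), bi_act Y k (Id H \<zeta>) b)
          (\<zeta>', bi_act X (Id H \<zeta>') g a, act ?Y' h (bi_act Y k (Id H \<zeta>) b))"
        using h X.bi_act_in[OF X.left.Id_in[OF o(2)] g a] Y.bi_act_in[OF k X.left.Id_in[OF o(1)] b]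
        by (intro coend_step.intros) auto
      then show ?thesis
        unfolding 1 using X.bi_act_interchange[OF h g a] Y.bi_act_interchange[OF k h b]
        by (auto intro!: r_into_equivclp)
    qed
  qed
  moreover have "Dom K k = \<kappa>" "Cod G g = \<gamma>'" using k g by (auto simp: Hom_def)
  ultimately show ?thesis
    by (simp add: tensor_def tensor_class_def tensor_rel_def)
qed

text \<open>Once the action is known on representatives, each law splits into the law of X in its
  covariant variable and the law of Y in its contravariant variable.\<close>

lemma biset_tensor:
  assumes X: "biset H G X" and Y: "biset K H Y"
  shows "biset K G (tensor K H G X Y)"
proof -
  interpret X: biset H G X by fact
  interpret Y: biset K H Y by fact
  note act = tensor_act_class[OF X Y]
  show ?thesis
  proof unfold_locales
    fix k \<kappa> \<kappa>' g \<gamma> \<gamma>' C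
    assume k: "k \<in> Hom K \<kappa> \<kappa>'" and g: "g \<in> Hom G \<gamma> \<gamma>'"
      and "C \<in> bi_elts (tensor K H G X Y) \<kappa>' \<gamma>"
    then obtain \<eta> x y where t: "\<eta> \<in> Obj H" "x \<in> bi_elts X \<eta> \<gamma>" "y \<in> bi_elts Y \<kappa>' \<eta>"
      and C: "C = tensor_class K H G X Y \<kappa>' \<gamma> (\<eta>, x, y)" by (auto elim: tensor_eltE)
    show "bi_act (tensor K H G X Y) k g C \<in> bi_elts (tensor K H G X Y) \<kappa> \<gamma>'"
      unfolding C act[OF k g t] using t(1)
      by (intro tensor_class_in)
         (simp add: X.bi_act_in[OF X.left.Id_in g t(2)] Y.bi_act_in[OF k X.left.Id_in t(3)])
  next
    fix \<kappa> \<gamma> C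
    assume o: "\<kappa> \<in> Obj K" "\<gamma> \<in> Obj G" and "C \<in> bi_elts (tensor K H G X Y) \<kappa> \<gamma>"
    then obtain \<eta> x y where t: "\<eta> \<in> Obj H" "x \<in> bi_elts X \<eta> \<gamma>" "y \<in> bi_elts Y \<kappa> \<eta>"
      and C: "C = tensor_class K H G X Y \<kappa> \<gamma> (\<eta>, x, y)" by (auto elim: tensor_eltE)
    show "bi_act (tensor K H G X Y) (Id K \<kappa>) (Id G \<gamma>) C = C"
      unfolding C act[OF Y.left.Id_in[OF o(1)] X.right.Id_in[OF o(2)] t]
      using X.bi_act_Id[OF t(1) o(2) t(2)] Y.bi_act_Id[OF o(1) t(1) t(3)] by simp
  next
    fix k \<kappa> \<kappa>' k' \<kappa>'' g \<gamma> \<gamma>' g' \<gamma>'' C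
    assume k: "k \<in> Hom K \<kappa> \<kappa>'" "k' \<in> Hom K \<kappa>' \<kappa>''"
      and g: "g \<in> Hom G \<gamma> \<gamma>'" "g' \<in> Hom G \<gamma>' \<gamma>''"
      and "C \<in> bi_elts (tensor K H G X Y) \<kappa>'' \<gamma>"
    then obtain \<eta> x y where t: "\<eta> \<in> Obj H" "x \<in> bi_elts X \<eta> \<gamma>" "y \<in> bi_elts Y \<kappa>'' \<eta>"
      and C: "C = tensor_class K H G X Y \<kappa>'' \<gamma> (\<eta>, x, y)" by (auto elim: tensor_eltE)
    note t' = t(1) X.bi_act_in[OF X.left.Id_in[OF t(1)] g(1) t(2)]
      Y.bi_act_in[OF k(2) X.left.Id_in[OF t(1)] t(3)]
    show "bi_act (tensor K H G X Y) (Comp K k' k) (Comp G g' g) C =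
        bi_act (tensor K H G X Y) k g' (bi_act (tensor K H G X Y) k' g C)"
      unfolding C act[OF Y.left.Comp_in[OF k] X.right.Comp_in[OF g] t] act[OF k(2) g(1) t]
        act[OF k(1) g(2) t']
      using X.bi_act_Comp_right[OF t(1) g t(2)] Y.bi_act_Comp_left[OF t(1) k t(3)] by simp
  qed
qed

lemma S_biset_simps [simp]:
  "bi_elts (S_biset G p) \<eta> \<gamma> = Hom G (on_obj p \<eta>) \<gamma>"
  "bi_act (S_biset G p) h g x = Comp G g (Comp G x (on_arr p h))"
  by (simp_all add: S_biset_def)

lemma T_biset_simps [simp]:
  "bi_elts (T_biset G p) \<gamma> \<eta> = Hom G \<gamma> (on_obj p \<eta>)"
  "bi_act (T_biset G p) g h x = Comp G (on_arr p h) (Comp G x g)"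
  by (simp_all add: T_biset_def)

lemma proj_simps [simp]:
  "on_obj proj_fst = fst" "on_arr proj_fst = fst" "on_obj proj_snd = snd" "on_arr proj_snd = snd"
  by (simp_all add: proj_fst_def proj_snd_def)


section \<open>Stability of finite covers under pullback\<close>

section \<open>Covers\<close>

lemma Obj_pullback:
  "\<xi> \<in> Obj (pullback H K p q) \<longleftrightarrow>
    fst \<xi> \<in> Obj H \<and> snd \<xi> \<in> Obj K \<and> on_obj p (fst \<xi>) = on_obj q (snd \<xi>)"
  by (cases \<xi>) (simp add: pullback_def)

lemma Hom_pullback:
  "f \<in> Hom (pullback H K p q) \<xi> \<xi>' \<longleftrightarrow> fst f \<in> Hom H (fst \<xi>) (fst \<xi>') \<and>
    snd f \<in> Hom K (snd \<xi>) (snd \<xi>') \<and> on_arr p (fst f) = on_arr q (snd f)"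
  by (cases f; cases \<xi>; cases \<xi>') (auto simp: Hom_def pullback_def)

text \<open>A lift of h in the pullback is h paired with a lift of \<open>on_arr p h\<close> along
  q, and the latter exists uniquely. The fibre over \<eta> is a copy of the fibre of q over
  \<open>on_obj p \<eta>\<close>.\<close>

lemma finite_cover_pullback:
  assumes p: "groupoid_functor H G p" and q: "finite_cover K G q"
  shows "finite_cover (pullback H K p q) H proj_fst"
proof -
  interpret p: groupoid_functor H G p by fact
  interpret q: finite_cover K G q by fact
  let ?P = "pullback H K p q"
  interpret pr: groupoid_functor ?P H proj_fst
    using p q.groupoid_functor_axioms by (rule groupoid_functor_proj)
  show ?thesis
  proof unfold_locales
    fix \<xi> \<eta> h
    assume "\<xi> \<in> Obj ?P" and \<eta>: "\<eta> \<in> Obj H" and "h \<in> Hom H (on_obj proj_fst \<xi>) \<eta>"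
    then have \<xi>: "fst \<xi> \<in> Obj H" "snd \<xi> \<in> Obj K" "on_obj p (fst \<xi>) = on_obj q (snd \<xi>)"
      and h: "h \<in> Hom H (fst \<xi>) \<eta>" by (auto simp: Obj_pullback)
    have "on_arr p h \<in> Hom G (on_obj q (snd \<xi>)) (on_obj p \<eta>)"
      using p.on_arr_in[OF h] \<xi>(3) by simp
    from q.unique_lift[OF \<xi>(2) p.on_obj_in[OF \<eta>] this]
    obtain \<kappa> k where k: "\<kappa> \<in> Obj K" "k \<in> Hom K (snd \<xi>) \<kappa>" "on_arr q k = on_arr p h"
      and uniq: "\<And>z. fst z \<in> Obj K \<Longrightarrow> snd z \<in> Hom K (snd \<xi>) (fst z) \<Longrightarrow>
        on_arr q (snd z) = on_arr p h \<Longrightarrow> z = (\<kappa>, k)"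
      by (metis prod.collapse)
    \<comment> \<open>The arrows \<open>on_arr q k\<close> and \<open>on_arr p h\<close> agree, so
      their targets do; this places \<open>(\<eta>, \<kappa>)\<close> in the pullback.\<close>
    have \<kappa>: "on_obj p \<eta> = on_obj q \<kappa>"
      using q.on_arr_in[OF k(2)] p.on_arr_in[OF h] k(3) by (auto simp: Hom_def)
    show "\<exists>!z. fst z \<in> Obj ?P \<and> snd z \<in> Hom ?P \<xi> (fst z) \<and> on_arr proj_fst (snd z) = h"
    proof (rule ex1I[of _ "((\<eta>, \<kappa>), (h, k))"])
      show "fst ((\<eta>, \<kappa>), (h, k)) \<in> Obj ?P \<and>
          snd ((\<eta>, \<kappa>), (h, k)) \<in> Hom ?P \<xi> (fst ((\<eta>, \<kappa>), (h, k))) \<and>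
          on_arr proj_fst (snd ((\<eta>, \<kappa>), (h, k))) = h"
        using \<eta> \<kappa> h k by (simp add: Obj_pullback Hom_pullback)
    next
      fix z assume z: "fst z \<in> Obj ?P \<and> snd z \<in> Hom ?P \<xi> (fst z) \<and> on_arr proj_fst (snd z) = h"
      \<comment> \<open>The K-part of any competing lift is itself a lift of
        \<open>on_arr p h\<close> along q, while its H-part is forced to be h with target
        \<eta>.\<close>
      then have "(snd (fst z), snd (snd z)) = (\<kappa>, k)"
        by (intro uniq) (auto simp: Obj_pullback Hom_pullback)
      moreover have "fst (snd z) = h" "fst (snd z) \<in> Hom H (fst \<xi>) (fst (fst z))"
        using z by (auto simp: Hom_pullback)
      then have "fst (snd z) = h" "fst (fst z) = \<eta>" using h by (auto simp: Hom_def)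
      ultimately show "z = ((\<eta>, \<kappa>), (h, k))" by (auto intro!: prod_eqI)
    qed
  next
    fix \<eta> assume "\<eta> \<in> Obj H"
    then have "finite ((\<lambda>\<kappa>. (\<eta>, \<kappa>)) ` {\<kappa> \<in> Obj K. on_obj q \<kappa> = on_obj p \<eta>})"
      using q.finite_fibre p.on_obj_in by simp
    then show "finite {\<xi> \<in> Obj ?P. on_obj proj_fst \<xi> = \<eta>}"
      by (rule finite_subset[rotated]) (auto simp: Obj_pullback image_iff)
  qed
qed

section \<open>Inverses, and lifting of arrows with prescribed target\<close>

context groupoid
begin

text \<open>Bracket the triple composite of u, f and v in both ways.\<close>

lemma right_inverse_eq:
  assumes f: "f \<in> Hom G x y" and u: "u \<in> Hom G y x" "Comp G u f = Id G x"
    and v: "v \<in> Hom G y x" "Comp G f v = Id G y"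
  shows "u = v"
  using Comp_assoc[OF v(1) f u(1)] Comp_Id[OF u(1)] Id_Comp[OF v(1)] u(2) v(2) by simp

end

context groupoid_functor
begin

lemma on_arr_right_inverse:
  assumes f: "f \<in> Hom H x y" and u: "u \<in> Hom H y x" "Comp H f u = Id H y"
  shows "Comp G (on_arr p f) (on_arr p u) = Id G (on_obj p y)"
  using on_arr_Comp[OF u(1) f] u(2) on_arr_Id source.Hom_objs[OF f] by simp

end

context cover
begin

lemma unique_lift_arr:
  assumes "k \<in> Hom K \<kappa>' \<kappa>" "l \<in> Hom K \<kappa>' \<mu>" "on_arr q k = on_arr q l"
  shows "\<kappa> = \<mu> \<and> k = l"
proof -
  have o: "\<kappa>' \<in> Obj K" "\<kappa> \<in> Obj K" "\<mu> \<in> Obj K"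
    using source.Hom_objs assms(1,2) by auto
  have "(\<kappa>, k) = (\<mu>, l)"
    using unique_lift[OF o(1) on_obj_in[OF o(2)] on_arr_in[OF assms(1)]] assms o
    by (metis fst_conv snd_conv)
  then show ?thesis by simp
qed

text \<open>The cover axiom prescribes the source of a lift. To prescribe the target instead, invert
  g, lift the inverse from \<kappa>, and invert the lift; its image and g are both inverse to
  \<open>g'\<close>, hence equal.\<close>

lemma lift_to_target:
  assumes \<kappa>: "\<kappa> \<in> Obj K" and g: "g \<in> Hom G \<gamma> (on_obj q \<kappa>)"
  obtains \<kappa>' k where "k \<in> Hom K \<kappa>' \<kappa>" "on_arr q k = g" "\<kappa>' \<in> Obj K" "on_obj q \<kappa>' = \<gamma>"
proof -
  obtain g' where g': "g' \<in> Hom G (on_obj q \<kappa>) \<gamma>" "Comp G g g' = Id G (on_obj q \<kappa>)"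
    using target.inverse_ex[OF g] by blast
  have \<gamma>: "\<gamma> \<in> Obj G" using target.Hom_objs[OF g] by simp
  obtain \<kappa>' k' where k': "\<kappa>' \<in> Obj K" "k' \<in> Hom K \<kappa> \<kappa>'" "on_arr q k' = g'"
    using unique_lift[OF \<kappa> \<gamma> g'(1)] by blast
  obtain k where k: "k \<in> Hom K \<kappa>' \<kappa>" "Comp K k' k = Id K \<kappa>'" "Comp K k k' = Id K \<kappa>"
    using source.inverse_ex[OF k'(2)] by blast
  have q\<kappa>': "on_obj q \<kappa>' = \<gamma>" using on_arr_in[OF k'(2)] k'(3) g'(1) by (auto simp: Hom_def)
  have "Comp G g' (on_arr q k) = Id G \<gamma>"
    using on_arr_right_inverse[OF k'(2) k(1,2)] k'(3) q\<kappa>' by simp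
  then have "g = on_arr q k"
    using target.right_inverse_eq[OF g'(1) g g'(2)] on_arr_in[OF k(1)] q\<kappa>' by simp
  then show thesis using that k(1) k'(1) q\<kappa>' by blast
qed

text \<open>The inverses of k and l both start at \<kappa> and have the same image under q, so
  uniqueness of lifts with given source identifies them, and with them k and l.\<close>

lemma unique_lift_to_target:
  assumes k: "k \<in> Hom K \<kappa>' \<kappa>" and l: "l \<in> Hom K \<mu>' \<kappa>" and eq: "on_arr q k = on_arr q l"
  shows "\<kappa>' = \<mu>' \<and> k = l"
proof -
  obtain k' where k': "k' \<in> Hom K \<kappa> \<kappa>'" "Comp K k' k = Id K \<kappa>'" "Comp K k k' = Id K \<kappa>"
    using source.inverse_ex[OF k] by blast
  obtain l' where l': "l' \<in> Hom K \<kappa> \<mu>'" "Comp K l' l = Id K \<mu>'" "Comp K l l' = Id K \<kappa>"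
    using source.inverse_ex[OF l] by blast
  have eq_obj: "on_obj q \<kappa>' = on_obj q \<mu>'"
    using on_arr_in[OF k] on_arr_in[OF l] eq by (auto simp: Hom_def)
  have "on_arr q k' = on_arr q l'"
  proof (rule target.right_inverse_eq[OF on_arr_in[OF k] on_arr_in[OF k'(1)]])
    show "Comp G (on_arr q k') (on_arr q k) = Id G (on_obj q \<kappa>')"
      by (rule on_arr_right_inverse[OF k'(1) k k'(2)])
    show "on_arr q l' \<in> Hom G (on_obj q \<kappa>) (on_obj q \<kappa>')"
      using on_arr_in[OF l'(1)] eq_obj by simp
    show "Comp G (on_arr q k) (on_arr q l') = Id G (on_obj q \<kappa>)"
      using on_arr_right_inverse[OF l l'(1,3)] eq by simp
  qed
  then have "\<kappa>' = \<mu>' \<and> k' = l'" by (rule unique_lift_arr[OF k'(1) l'(1)])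
  then show ?thesis using source.right_inverse_eq[OF k'(1) k k'(3)] l l'(2) by simp
qed

end


section \<open>Complete invariants for the classes on each side\<close>

section \<open>Both tensor products as hom-sets\<close>

text \<open>This is the co-Yoneda isomorphism. Associativity makes the composite constant on steps;
  conversely every triple slides to a normal form that depends only on the composite.\<close>

lemma equivclp_TS_iff:
  fixes G :: "('go, 'ga) groupoid"
  assumes "groupoid_functor H G p" "groupoid_functor K G q" "\<eta> \<in> Obj H" "\<kappa> \<in> Obj K"
    and t: "a \<in> Hom G \<gamma> (on_obj q \<kappa>)" "b \<in> Hom G (on_obj p \<eta>) \<gamma>"
      "a' \<in> Hom G \<gamma>' (on_obj q \<kappa>)" "b' \<in> Hom G (on_obj p \<eta>) \<gamma>'"
  shows "equivclp (coend_step G (lower_slice K (T_biset G q) \<kappa>) (upper_slice H (S_biset G p) \<eta>))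
      (\<gamma>, a, b) (\<gamma>', a', b') \<longleftrightarrow> Comp G a b = Comp G a' b'"
proof -
  interpret p: groupoid_functor H G p by fact
  interpret q: groupoid_functor K G q by fact
  let ?X = "lower_slice K (T_biset G q) \<kappa>" and ?Y = "upper_slice H (S_biset G p) \<eta>"
  let ?R = "equivclp (coend_step G ?X ?Y)"
  define w where "w = (\<lambda>(\<gamma> :: 'go, a, b). Comp G a b)"
  have actX: "act ?X g x = Comp G x g"
    if "g \<in> Hom G \<gamma> \<gamma>'" "x \<in> Hom G \<gamma>' (on_obj q \<kappa>)" for g x \<gamma> \<gamma>'
    using p.target.Id_Comp[OF p.target.Comp_in[OF that]] by (simp add: q.on_arr_Id assms(4))
  have actY: "act ?Y g y = Comp G g y" if "y \<in> Hom G (on_obj p \<eta>) \<gamma>" for g y \<gamma>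
    using p.target.Comp_Id[OF that] by (simp add: p.on_arr_Id assms(3))
  have inv: "w s = w t" if "coend_step G ?X ?Y s t" for s t
    using that
  proof cases
    case (1 g \<gamma> \<gamma>' x y)
    then have g: "g \<in> Hom G \<gamma> \<gamma>'" and x: "x \<in> Hom G \<gamma>' (on_obj q \<kappa>)"
      and y: "y \<in> Hom G (on_obj p \<eta>) \<gamma>" by auto
    show ?thesis
      unfolding 1 w_def prod.case actX[OF g x] actY[OF y]
      by (rule p.target.Comp_assoc[OF y g x, symmetric])
  qed
  \<comment> \<open>Write a as the identity at \<open>on_obj q \<kappa>\<close> acted on by a, and
    move a across the tensor sign onto b.\<close>
  have canon: "?R (\<gamma>, a, b) (on_obj q \<kappa>, Id G (on_obj q \<kappa>), Comp G a b)"
    if a: "a \<in> Hom G \<gamma> (on_obj q \<kappa>)" and b: "b \<in> Hom G (on_obj p \<eta>) \<gamma>" for \<gamma> a b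
  proof -
    have I: "Id G (on_obj q \<kappa>) \<in> Hom G (on_obj q \<kappa>) (on_obj q \<kappa>)"
      using p.target.Id_in q.on_obj_in assms(4) by blast
    have "coend_step G ?X ?Y (\<gamma>, act ?X a (Id G (on_obj q \<kappa>)), b)
        (on_obj q \<kappa>, Id G (on_obj q \<kappa>), act ?Y a b)"
      using a b I by (intro coend_step.intros) auto
    then show ?thesis
      unfolding actX[OF a I] actY[OF b] p.target.Id_Comp[OF a] by (rule r_into_equivclp)
  qed
  have "w s = w t" if "?R s t" for s t
    by (rule equivclp_invariant[where w = w, OF that inv])
  moreover have "?R (\<gamma>, a, b) (\<gamma>', a', b')" if "Comp G a b = Comp G a' b'"
    using equivclp_trans[OF canon[OF t(1,2)] equivclp_sym[OF canon[OF t(3,4), folded that]]] .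
  ultimately show ?thesis unfolding w_def by fastforce
qed

text \<open>A pullback arrow \<open>(u, v)\<close> has equal images under p and q, so moving it
  across the tensor sign leaves the composite in G unchanged. Conversely, each triple slides to one
  whose last entry is an identity, and its middle entry is then a lift of the composite ending at
  \<kappa>.\<close>

lemma equivclp_pullback_ST_iff:
  fixes H :: "('ho, 'ha) groupoid" and K :: "('ko, 'ka) groupoid"
  assumes "groupoid_functor H G p" "cover K G q" "\<eta> \<in> Obj H" "\<kappa> \<in> Obj K"
    and t: "\<xi> \<in> Obj (pullback H K p q)" "k \<in> Hom K (snd \<xi>) \<kappa>" "h \<in> Hom H \<eta> (fst \<xi>)"
      "\<xi>' \<in> Obj (pullback H K p q)" "k' \<in> Hom K (snd \<xi>') \<kappa>" "h' \<in> Hom H \<eta> (fst \<xi>')"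
  shows "equivclp (coend_step (pullback H K p q) (lower_slice K (S_biset K proj_snd) \<kappa>)
        (upper_slice H (T_biset H proj_fst) \<eta>)) (\<xi>, k, h) (\<xi>', k', h') \<longleftrightarrow>
      Comp G (on_arr q k) (on_arr p h) = Comp G (on_arr q k') (on_arr p h')"
proof -
  interpret p: groupoid_functor H G p by fact
  interpret q: cover K G q by fact
  let ?P = "pullback H K p q"
  let ?X = "lower_slice K (S_biset K proj_snd) \<kappa> :: ('ho \<times> 'ko, 'ha \<times> 'ka, 'ka) gset"
  let ?Y = "upper_slice H (T_biset H proj_fst) \<eta> :: ('ho \<times> 'ko, 'ha \<times> 'ka, 'ha) gset"
  let ?R = "equivclp (coend_step ?P ?X ?Y)"
  define w where "w = (\<lambda>(\<xi> :: 'ho \<times> 'ko, k, h). Comp G (on_arr q k) (on_arr p h))"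
  have actX: "act ?X (h, m) k = Comp K k m"
    if "m \<in> Hom K \<kappa>'' \<kappa>'" "k \<in> Hom K \<kappa>' \<kappa>" for h m k \<kappa>' \<kappa>''
    using q.source.Id_Comp[OF q.source.Comp_in[OF that]] by simp
  have actY: "act ?Y (m, k) h = Comp H m h" if "h \<in> Hom H \<eta> \<eta>'" for m h k \<eta>'
    using p.source.Comp_Id[OF that] by simp
  have inv: "w s = w t" if "coend_step ?P ?X ?Y s t" for s t
    using that
  proof cases
    case (1 f \<zeta> \<zeta>' x y)
    obtain u v where f: "f = (u, v)" by (cases f)
    have u: "u \<in> Hom H (fst \<zeta>) (fst \<zeta>')" and v: "v \<in> Hom K (snd \<zeta>) (snd \<zeta>')"
      and uv: "on_arr p u = on_arr q v"
      using 1 by (auto simp: f Hom_pullback)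
    have x: "x \<in> Hom K (snd \<zeta>') \<kappa>" and y: "y \<in> Hom H \<eta> (fst \<zeta>)" using 1 by auto
    \<comment> \<open>This arrow is also \<open>on_arr p u\<close>; with its source read as
      \<open>on_obj p (fst \<zeta>)\<close> it fits between the images of y and x in the
      associativity law.\<close>
    have "on_arr q v \<in> Hom G (on_obj p (fst \<zeta>)) (on_obj q (snd \<zeta>'))"
      using p.on_arr_in[OF u] q.on_arr_in[OF v] uv by (auto simp: Hom_def)
    then show ?thesis
      unfolding 1 f w_def
      using actX[OF v x] actY[OF y] q.on_arr_Comp[OF v x] p.on_arr_Comp[OF y u] uv
        p.target.Comp_assoc[OF p.on_arr_in[OF y] _ q.on_arr_in[OF x]] by simp
  qed
  have canon: "\<exists>\<mu> l. l \<in> Hom K \<mu> \<kappa> \<and> on_arr q l = Comp G (on_arr q k) (on_arr p h) \<and>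
      ?R (\<xi>, k, h) ((\<eta>, \<mu>), l, Id H \<eta>)"
    if \<xi>: "\<xi> \<in> Obj ?P" and k: "k \<in> Hom K (snd \<xi>) \<kappa>" and h: "h \<in> Hom H \<eta> (fst \<xi>)" for \<xi> k h
  proof -
    have "on_arr p h \<in> Hom G (on_obj p \<eta>) (on_obj q (snd \<xi>))" "snd \<xi> \<in> Obj K"
      using p.on_arr_in[OF h] \<xi> by (auto simp: Obj_pullback)
    \<comment> \<open>Lifting along q to the target \<open>snd \<xi>\<close> turns h into the arrow
      \<open>(h, m)\<close> of the pullback, along which h can be moved to the other factor.\<close>
    then obtain \<mu> m where m: "m \<in> Hom K \<mu> (snd \<xi>)" "on_arr q m = on_arr p h"
      using q.lift_to_target by metis
    have I: "Id H \<eta> \<in> Hom H \<eta> \<eta>" using p.source.Id_in assms(3) by blast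
    have "(h, m) \<in> Hom ?P (\<eta>, \<mu>) \<xi>" using h m by (simp add: Hom_pullback)
    then have "coend_step ?P ?X ?Y ((\<eta>, \<mu>), act ?X (h, m) k, Id H \<eta>) (\<xi>, k, act ?Y (h, m) (Id H \<eta>))"
      using k I by (intro coend_step.intros) auto
    then have "?R (\<xi>, k, h) ((\<eta>, \<mu>), Comp K k m, Id H \<eta>)"
      unfolding actX[OF m(1) k] actY[OF I] p.source.Comp_Id[OF h]
      by (blast intro: equivclp_sym)
    moreover have "Comp K k m \<in> Hom K \<mu> \<kappa>" using q.source.Comp_in[OF m(1) k] .
    moreover have "on_arr q (Comp K k m) = Comp G (on_arr q k) (on_arr p h)"
      using q.on_arr_Comp[OF m(1) k] m(2) by simp
    ultimately show ?thesis by blast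
  qed
  have "w s = w t" if "?R s t" for s t
    by (rule equivclp_invariant[where w = w, OF that inv])
  moreover have "?R (\<xi>, k, h) (\<xi>', k', h')"
    if eq: "Comp G (on_arr q k) (on_arr p h) = Comp G (on_arr q k') (on_arr p h')"
  proof -
    obtain \<mu> l where l: "l \<in> Hom K \<mu> \<kappa>" "on_arr q l = Comp G (on_arr q k) (on_arr p h)"
      "?R (\<xi>, k, h) ((\<eta>, \<mu>), l, Id H \<eta>)" using canon[OF t(1-3)] by blast
    obtain \<mu>' l' where l': "l' \<in> Hom K \<mu>' \<kappa>" "on_arr q l' = Comp G (on_arr q k') (on_arr p h')"
      "?R (\<xi>', k', h') ((\<eta>, \<mu>'), l', Id H \<eta>)" using canon[OF t(4-6)] by blast
    \<comment> \<open>Both normal forms lift the same arrow to the same target \<kappa>, so they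
      coincide, including the object \<mu>.\<close>
    have "\<mu> = \<mu>' \<and> l = l'" using q.unique_lift_to_target[OF l(1) l'(1)] l(2) l'(2) eq by simp
    then show ?thesis using equivclp_trans[OF l(3)] equivclp_sym[OF l'(3)] by simp
  qed
  ultimately show ?thesis unfolding w_def by fastforce
qed

section \<open>Assembly of the natural isomorphism\<close>

theorem mainTheorem5:
  fixes G :: "('go, 'ga) groupoid" and H :: "('ho, 'ha) groupoid" and K :: "('ko, 'ka) groupoid"
    and p :: "('ho, 'ha, 'go, 'ga) gfunctor" and q :: "('ko, 'ka, 'go, 'ga) gfunctor"
  assumes "groupoid G" and "groupoid H" and "groupoid K"
    and "groupoid_functor H G p"
    and "finite_cover K G q"
  shows "let P = pullback H K p q;
             pbar = (proj_snd :: ('ho \<times> 'ko, 'ha \<times> 'ka, 'ko, 'ka) gfunctor);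
             qbar = (proj_fst :: ('ho \<times> 'ko, 'ha \<times> 'ka, 'ho, 'ha) gfunctor)
         in finite_cover P H qbar \<and>
            (\<exists>\<alpha>. biset_natural_iso H K
                    (tensor H P K (S_biset K pbar) (T_biset H qbar))
                    (tensor H G K (T_biset G q) (S_biset G p)) \<alpha> \<and>
                 (\<forall>\<kappa> \<in> Obj K. \<forall>\<eta> \<in> Obj H. \<forall>\<xi> \<in> Obj P.
                  \<forall>k \<in> Hom K (on_obj pbar \<xi>) \<kappa>. \<forall>h \<in> Hom H \<eta> (on_obj qbar \<xi>).
                    \<alpha> \<eta> \<kappa> (tensor_class H P K (S_biset K pbar) (T_biset H qbar) \<eta> \<kappa> (\<xi>, k, h)) =
                    tensor_class H G K (T_biset G q) (S_biset G p) \<eta> \<kappa>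
                      (on_obj q (on_obj pbar \<xi>), on_arr q k, on_arr p h)))"
proof -
  interpret p: groupoid_functor H G p by fact
  interpret q: finite_cover K G q by fact
  note p = p.groupoid_functor_axioms and q = q.groupoid_functor_axioms
  let ?P = "pullback H K p q"
  let ?S = "S_biset K proj_snd :: ('ho \<times> 'ko, 'ha \<times> 'ka, 'ko, 'ka, 'ka) biset"
  let ?T = "T_biset H proj_fst :: ('ho, 'ha, 'ho \<times> 'ko, 'ha \<times> 'ka, 'ha) biset"
  let ?L = "tensor H ?P K ?S ?T"
  let ?R = "tensor H G K (T_biset G q) (S_biset G p)"
  let ?cL = "tensor_class H ?P K ?S ?T"
  let ?cR = "tensor_class H G K (T_biset G q) (S_biset G p)"
  let ?stepL = "\<lambda>\<eta> \<kappa>. coend_step ?P (lower_slice K ?S \<kappa>) (upper_slice H ?T \<eta>)"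
  let ?stepR = "\<lambda>\<eta> \<kappa>. coend_step G (lower_slice K (T_biset G q) \<kappa>) (upper_slice H (S_biset G p) \<eta>)"
  \<comment> \<open>This is the map on representatives. Its index
    \<open>on_obj q (snd \<xi>)\<close> equals \<open>on_obj p (fst \<xi>)\<close> on the pullback,
    so it is the source of \<open>on_arr q k\<close> and the target of
    \<open>on_arr p h\<close>.\<close>
  define f where "f = (\<lambda>(\<xi> :: 'ho \<times> 'ko, k, h). (on_obj q (snd \<xi>), on_arr q k, on_arr p h))"
  \<comment> \<open>Saturating the image avoids choosing a representative;
    \<open>\<alpha>_class\<close> shows that the result is the class of the image.\<close>
  define \<alpha> where "\<alpha> = (\<lambda>\<eta> \<kappa> C. tensor_rel H G K (T_biset G q) (S_biset G p) \<eta> \<kappa> `` (f ` C))"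
  have S: "biset ?P K ?S" using biset_S groupoid_functor_proj(2)[OF p q] .
  have T: "biset H ?P ?T" using biset_T groupoid_functor_proj(1)[OF p q] .
  note S' = biset_S[OF p] and T' = biset_T[OF q]
  interpret S: biset ?P K ?S by (rule S)
  interpret T: biset H ?P ?T by (rule T)
  interpret L: biset H K ?L using S T by (rule biset_tensor)
  interpret R: biset H K ?R using T' S' by (rule biset_tensor)
  have f_in: "on_obj q (snd \<xi>) \<in> Obj G" "on_arr q k \<in> Hom G (on_obj q (snd \<xi>)) (on_obj q \<kappa>)"
      "on_arr p h \<in> Hom G (on_obj p \<eta>) (on_obj q (snd \<xi>))"
    if "\<xi> \<in> Obj ?P" "k \<in> Hom K (snd \<xi>) \<kappa>" "h \<in> Hom H \<eta> (fst \<xi>)" for \<xi> k h \<eta> \<kappa>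
    using that(1) q.on_arr_in[OF that(2)] p.on_arr_in[OF that(3)] q.on_obj_in
    by (auto simp: Obj_pullback)
  \<comment> \<open>Both equivalences amount to equality of the same arrows
    \<open>Comp G (on_arr q k) (on_arr p h)\<close>. One direction makes \<alpha> well defined, the
    other makes it injective.\<close>
  have f_equiv: "equivclp (?stepR \<eta> \<kappa>) (f (\<xi>, k, h)) (f (\<xi>', k', h')) \<longleftrightarrow>
      equivclp (?stepL \<eta> \<kappa>) (\<xi>, k, h) (\<xi>', k', h')"
    if o: "\<eta> \<in> Obj H" "\<kappa> \<in> Obj K"
      and t: "\<xi> \<in> Obj ?P" "k \<in> Hom K (snd \<xi>) \<kappa>" "h \<in> Hom H \<eta> (fst \<xi>)"
        "\<xi>' \<in> Obj ?P" "k' \<in> Hom K (snd \<xi>') \<kappa>" "h' \<in> Hom H \<eta> (fst \<xi>')"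
    for \<eta> \<kappa> \<xi> k h \<xi>' k' h'
    unfolding equivclp_pullback_ST_iff[OF p q.cover_axioms o t] f_def prod.case
    by (rule equivclp_TS_iff[OF p q o f_in(2,3)[OF t(1-3)] f_in(2,3)[OF t(4-6)]])
  have \<alpha>_class: "\<alpha> \<eta> \<kappa> (?cL \<eta> \<kappa> (\<xi>, k, h)) = ?cR \<eta> \<kappa> (f (\<xi>, k, h))"
    if o: "\<eta> \<in> Obj H" "\<kappa> \<in> Obj K"
      and t: "\<xi> \<in> Obj ?P" "k \<in> Hom K (snd \<xi>) \<kappa>" "h \<in> Hom H \<eta> (fst \<xi>)" for \<eta> \<kappa> \<xi> k h
    unfolding \<alpha>_def tensor_class_def tensor_rel_def
  proof (rule coend_rel_image_class)
    show "(\<xi>, k, h) \<in> coprod ?P (lower_slice K ?S \<kappa>) (upper_slice H ?T \<eta>)" using t by simp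
  next
    fix u assume "u \<in> coprod ?P (lower_slice K ?S \<kappa>) (upper_slice H ?T \<eta>)"
    then show "f u \<in> coprod G (lower_slice K (T_biset G q) \<kappa>) (upper_slice H (S_biset G p) \<eta>)"
      using f_in[of "fst u" "fst (snd u)" \<kappa> "snd (snd u)" \<eta>]
      by (cases u) (auto simp: f_def)
  next
    fix u v assume step: "?stepL \<eta> \<kappa> u v"
    then show "equivclp (?stepR \<eta> \<kappa>) (f u) (f v)"
    proof cases
      case (1 g \<zeta> \<zeta>' x y)
      then have g: "g \<in> Hom ?P \<zeta> \<zeta>'"
        and x: "x \<in> bi_elts ?S \<zeta>' \<kappa>" and y: "y \<in> bi_elts ?T \<eta> \<zeta>" by auto
      \<comment> \<open>\<open>f_equiv\<close> needs both ends of the step to be genuine triples;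
        the step supplies x and y, and the entries moved by g have to be placed separately.\<close>
      have "\<zeta> \<in> Obj ?P" "\<zeta>' \<in> Obj ?P" using S.left.Hom_objs[OF g] by auto
      moreover have "bi_act ?S g (Id K \<kappa>) x \<in> bi_elts ?S \<zeta> \<kappa>"
        using S.bi_act_in[OF g q.source.Id_in[OF o(2)] x] .
      moreover have "bi_act ?T (Id H \<eta>) g y \<in> bi_elts ?T \<eta> \<zeta>'"
        using T.bi_act_in[OF p.source.Id_in[OF o(1)] g y] .
      ultimately show ?thesis
        using f_equiv[OF o, of \<zeta> "bi_act ?S g (Id K \<kappa>) x" y \<zeta>' x "bi_act ?T (Id H \<eta>) g y"]
          x y r_into_equivclp[of "?stepL \<eta> \<kappa>", OF step]
        unfolding 1 by simp
    qed
  qed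
  have "biset_natural_iso H K ?L ?R \<alpha>"
  proof unfold_locales
    fix \<eta> \<kappa> assume o: "\<eta> \<in> Obj H" "\<kappa> \<in> Obj K"
    show "bij_betw (\<alpha> \<eta> \<kappa>) (bi_elts ?L \<eta> \<kappa>) (bi_elts ?R \<eta> \<kappa>)"
    proof (rule bij_betwI')
      fix C D assume "C \<in> bi_elts ?L \<eta> \<kappa>" "D \<in> bi_elts ?L \<eta> \<kappa>"
      then obtain \<xi> k h \<xi>' k' h'
        where t: "\<xi> \<in> Obj ?P" "k \<in> Hom K (snd \<xi>) \<kappa>" "h \<in> Hom H \<eta> (fst \<xi>)"
            "\<xi>' \<in> Obj ?P" "k' \<in> Hom K (snd \<xi>') \<kappa>" "h' \<in> Hom H \<eta> (fst \<xi>')"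
          and CD: "C = ?cL \<eta> \<kappa> (\<xi>, k, h)" "D = ?cL \<eta> \<kappa> (\<xi>', k', h')"
        by (auto elim!: tensor_eltE)
      have "?cR \<eta> \<kappa> (f (\<xi>, k, h)) = ?cR \<eta> \<kappa> (f (\<xi>', k', h')) \<longleftrightarrow>
          equivclp (?stepR \<eta> \<kappa>) (f (\<xi>, k, h)) (f (\<xi>', k', h'))"
        unfolding tensor_class_def tensor_rel_def
        by (rule coend_class_eq_iff) (use f_in[OF t(1-3)] f_in[OF t(4-6)] in \<open>auto simp: f_def\<close>)
      moreover have "C = D \<longleftrightarrow> equivclp (?stepL \<eta> \<kappa>) (\<xi>, k, h) (\<xi>', k', h')"
        unfolding CD tensor_class_def tensor_rel_def
        by (rule coend_class_eq_iff) (use t in auto)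
      ultimately show "\<alpha> \<eta> \<kappa> C = \<alpha> \<eta> \<kappa> D \<longleftrightarrow> C = D"
        using f_equiv[OF o t] \<alpha>_class[OF o t(1-3)] \<alpha>_class[OF o t(4-6)] CD by simp
    next
      fix C assume "C \<in> bi_elts ?L \<eta> \<kappa>"
      then obtain \<xi> k h where t: "\<xi> \<in> Obj ?P" "k \<in> Hom K (snd \<xi>) \<kappa>" "h \<in> Hom H \<eta> (fst \<xi>)"
        and C: "C = ?cL \<eta> \<kappa> (\<xi>, k, h)" by (auto elim!: tensor_eltE)
      show "\<alpha> \<eta> \<kappa> C \<in> bi_elts ?R \<eta> \<kappa>"
        unfolding C \<alpha>_class[OF o t] f_def prod.case
        by (rule tensor_class_in) (use f_in[OF t] in auto)
    next
      fix D assume "D \<in> bi_elts ?R \<eta> \<kappa>"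
      then obtain \<gamma> a b
        where t: "\<gamma> \<in> Obj G" "a \<in> Hom G \<gamma> (on_obj q \<kappa>)" "b \<in> Hom G (on_obj p \<eta>) \<gamma>"
          and D: "D = ?cR \<eta> \<kappa> (\<gamma>, a, b)" by (auto elim!: tensor_eltE)
      note ab = p.target.Comp_in[OF t(3,2)]
      \<comment> \<open>Surjectivity: lift the composite of a and b to the target \<kappa>. Its
        source \<mu> lies over \<open>on_obj p \<eta>\<close>, and the preimage is the class of l
        together with the identity of \<eta>.\<close>
      obtain \<mu> l where l: "l \<in> Hom K \<mu> \<kappa>" "on_arr q l = Comp G a b" "\<mu> \<in> Obj K"
        "on_obj q \<mu> = on_obj p \<eta>"
        using q.lift_to_target[OF o(2) ab] by blast
      have s: "(\<eta>, \<mu>) \<in> Obj ?P" "l \<in> Hom K (snd (\<eta>, \<mu>)) \<kappa>" "Id H \<eta> \<in> Hom H \<eta> (fst (\<eta>, \<mu>))"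
        using l o p.source.Id_in by (auto simp: Obj_pullback)
      have "equivclp (?stepR \<eta> \<kappa>) (\<gamma>, a, b) (f ((\<eta>, \<mu>), l, Id H \<eta>))"
        unfolding f_def prod.case equivclp_TS_iff[OF p q o t(2,3) f_in(2,3)[OF s]]
        using p.target.Comp_Id[OF ab] l(2) by (simp add: p.on_arr_Id o)
      then have "D = ?cR \<eta> \<kappa> (f ((\<eta>, \<mu>), l, Id H \<eta>))"
        unfolding D tensor_class_def tensor_rel_def
        by (subst coend_class_eq_iff) (use t f_in[OF s] in \<open>auto simp: f_def\<close>)
      then have "D = \<alpha> \<eta> \<kappa> (?cL \<eta> \<kappa> ((\<eta>, \<mu>), l, Id H \<eta>))"
        using \<alpha>_class[OF o s] by simp
      moreover have "?cL \<eta> \<kappa> ((\<eta>, \<mu>), l, Id H \<eta>) \<in> bi_elts ?L \<eta> \<kappa>"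
        by (rule tensor_class_in) (use s in auto)
      ultimately show "\<exists>C \<in> bi_elts ?L \<eta> \<kappa>. D = \<alpha> \<eta> \<kappa> C" by blast
    qed
  next
    fix g \<eta> \<eta>' m \<kappa> \<kappa>' C
    assume g: "g \<in> Hom H \<eta> \<eta>'" and m: "m \<in> Hom K \<kappa> \<kappa>'" and "C \<in> bi_elts ?L \<eta>' \<kappa>"
    then obtain \<xi> k h where t: "\<xi> \<in> Obj ?P" "k \<in> bi_elts ?S \<xi> \<kappa>" "h \<in> bi_elts ?T \<eta>' \<xi>"
      and C: "C = ?cL \<eta>' \<kappa> (\<xi>, k, h)" by (blast elim: tensor_eltE)
    have o: "\<eta> \<in> Obj H" "\<eta>' \<in> Obj H" "\<kappa> \<in> Obj K" "\<kappa>' \<in> Obj K"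
      using p.source.Hom_objs[OF g] q.source.Hom_objs[OF m] by auto
    have k: "k \<in> Hom K (snd \<xi>) \<kappa>" and h: "h \<in> Hom H \<eta>' (fst \<xi>)" using t by auto
    have Id_P: "Id ?P \<xi> = (Id H (fst \<xi>), Id K (snd \<xi>))" by (simp add: pullback_def case_prod_beta)
    \<comment> \<open>The outer action of m and g keeps \<xi> fixed, so the identity of \<xi> in the
      pullback drops out and only composition with m and g remains.\<close>
    have actS: "bi_act ?S (Id ?P \<xi>) m k = Comp K m k"
      using q.source.Comp_Id[OF k] by (simp add: Id_P)
    have actT: "bi_act ?T g (Id ?P \<xi>) h = Comp H h g"
      using p.source.Id_Comp[OF p.source.Comp_in[OF g h]] by (simp add: Id_P)
    note mk = q.source.Comp_in[OF k m] and hg = p.source.Comp_in[OF g h]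
    note fs = f_in[OF t(1) k h]
    have pg: "Comp G (on_arr p h) (on_arr p g) \<in> Hom G (on_obj p \<eta>) (on_obj q (snd \<xi>))"
      using p.target.Comp_in[OF p.on_arr_in[OF g] fs(3)] .
    have "\<alpha> \<eta> \<kappa>' (bi_act ?L g m C) = ?cR \<eta> \<kappa>' (f (\<xi>, Comp K m k, Comp H h g))"
      unfolding C tensor_act_class[OF S T g m t] actS actT
      by (rule \<alpha>_class[OF o(1,4) t(1) mk hg])
    \<comment> \<open>Naturality is functoriality of q on \<open>Comp K m k\<close> and of p on
      \<open>Comp H h g\<close>; the remaining facts remove the identities at
      \<open>on_obj q (snd \<xi>)\<close>.\<close>
    also have "\<dots> = bi_act ?R g m (?cR \<eta>' \<kappa> (f (\<xi>, k, h)))"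
      unfolding f_def prod.case
      by (subst tensor_act_class[OF T' S' g m])
         (use fs q.on_arr_Comp[OF k m] p.on_arr_Comp[OF g h] p.target.Comp_Id[OF fs(2)]
            p.target.Id_Comp[OF pg] in auto)
    also have "\<dots> = bi_act ?R g m (\<alpha> \<eta>' \<kappa> C)"
      unfolding C \<alpha>_class[OF o(2,3) t(1) k h] ..
    finally show "\<alpha> \<eta> \<kappa>' (bi_act ?L g m C) = bi_act ?R g m (\<alpha> \<eta>' \<kappa> C)" .
  qed
  moreover have "\<forall>\<kappa> \<in> Obj K. \<forall>\<eta> \<in> Obj H. \<forall>\<xi> \<in> Obj ?P.
      \<forall>k \<in> Hom K (snd \<xi>) \<kappa>. \<forall>h \<in> Hom H \<eta> (fst \<xi>).
        \<alpha> \<eta> \<kappa> (?cL \<eta> \<kappa> (\<xi>, k, h)) = ?cR \<eta> \<kappa> (on_obj q (snd \<xi>), on_arr q k, on_arr p h)"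
    using \<alpha>_class by (simp add: f_def)
  ultimately show ?thesis
    using finite_cover_pullback[OF p q.finite_cover_axioms] unfolding Let_def proj_simps by blast
qed

end
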